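(* Let $\mathcal A$ be a hyperplane arrangement and let $P_{\mathcal N}$ be an irreducible component of $\mathcal R(\mathcal A)$ corresponding to a multinet $\mathcal N$ on a sub-arrangement $\mathcal B\subsetneq\mathcal A$. Assume that for any $Y\in L_2(\mathcal A)$ that is the intersection of two hyperplanes in $\mathcal B$ one has $|\mathcal A_Y|\le3$. Then $P_{\mathcal N}$ is separable, that is, $(P_{\mathcal N}\wedge V^\vee)\cap K^\perp\subseteq\bigwedge^2P_{\mathcal N}$.
   Context: An arrangement $\mathcal A$ is a finite set of linear hyperplanes (through the origin) in $\mathbb C^\ell$. $L_2(\mathcal A)$ is the set of $2$-flats, i.e. codimension $2$ subspaces that are intersections of hyperplanes of $\mathcal A$; for $X\in L_2(\mathcal A)$ set $\mathcal A_X=\{H\in\mathcal A:X\subseteq H\}$. $V^\vee=H^1(M(\mathcal A),\mathbb C)$, where $M(\mathcal A)$ is the complement, is the vector space with basis $\{e_H\}_{H\in\mathcal A}$. $K^\perp=I^2(\mathcal A)\subseteq\bigwedge^2V^\vee$ is the kernel of the cup product $\bigwedge^2H^1(M(\mathcal A),\mathbb C)\to H^2(M(\mathcal A),\mathbb C)$; equivalently, the span of the elements $(e_H-e_{H''})\wedge(e_{H'}-e_{H''})$ for distinct $H,H',H''\in\mathcal A$ with $\mathrm{codim}(H\cap H'\cap H'')=2$. The resonance variety is $\mathcal R(\mathcal A)=\{a\in V^\vee:\exists\, b\in V^\vee,\ a\wedge b\in K^\perp\setminus\{0\}\}\cup\{0\}$, which is a finite union of linear subspaces. A $k$-multinet $\mathcal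 N$ ($k\ge3$) on an arrangement $\mathcal B$ is a partition $\mathcal B=\mathcal B_1\sqcup\cdots\sqcup\mathcal B_k$ with multiplicities $m:\mathcal B\to\mathbb Z_{>0}$ and a subset $\mathcal X\subseteq L_2(\mathcal B)$ (the base locus) such that: (i) there is $d$ with $\sum_{H\in\mathcal B_i}m_H=d$ for all $i$; (ii) $H\cap H'\in\mathcal X$ for $H,H'$ in different classes; (iii) for each $X\in\mathcal X$, $\sum_{H\in\mathcal B_i,\,H\supset X}m_H$ is independent of $i$; (iv) for each $i$, $(\bigcup_{H\in\mathcal B_i}H)\setminus\bigcup_{X\in\mathcal X}X$ is connected. For a multinet on $\mathcal B\subseteq\mathcal A$, with $u_i=\sum_{H\in\mathcal B_i}m_He_H$, set $P_{\mathcal N}=\mathrm{span}\{u_2-u_1,\dots,u_k-u_1\}\subseteq V^\vee$. *)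

theory Defs
  imports "HOL-Analysis.Analysis" "HOL-Library.Function_Algebras"
begin

section \<open>Arrangements in complex \<open>\<ell>\<close>-space, with \<open>\<ell> = CARD('n)\<close>\<close>

definition codim :: "(complex ^ 'n) set \<Rightarrow> nat" where
  "codim X = CARD('n) - vec.dim X"

definition hyperplane :: "(complex ^ 'n) set \<Rightarrow> bool" where
  "hyperplane H \<longleftrightarrow> vec.subspace H \<and> codim H = 1"

definition arrangement :: "(complex ^ 'n) set set \<Rightarrow> bool" where
  "arrangement \<A> \<longleftrightarrow> finite \<A> \<and> (\<forall>H\<in>\<A>. hyperplane H)"

definition flats2 :: "(complex ^ 'n) set set \<Rightarrow> (complex ^ 'n) set set" where
  "flats2 \<A> = {X. (\<exists>S\<subseteq>\<A>. X = \<Inter>S) \<and> codim X = 2}"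

definition localization ::
    "(complex ^ 'n) set set \<Rightarrow> (complex ^ 'n) set \<Rightarrow> (complex ^ 'n) set set" where
  "localization \<A> X = {H \<in> \<A>. X \<subseteq> H}"


section \<open>Degree one and two cohomology classes\<close>

definition cscale :: "complex \<Rightarrow> ('h \<Rightarrow> complex) \<Rightarrow> 'h \<Rightarrow> complex" where
  "cscale c f = (\<lambda>x. c * f x)"

global_interpretation cfun: vector_space "cscale :: complex \<Rightarrow> ('h \<Rightarrow> complex) \<Rightarrow> 'h \<Rightarrow> complex"
  by unfold_locales (auto simp: cscale_def fun_eq_iff algebra_simps)

definition ebasis :: "'h \<Rightarrow> 'h \<Rightarrow> complex" where
  "ebasis H = (\<lambda>H'. if H' = H then 1 else 0)"

text \<open>
  The space \<open>H\<^sup>1(M(\<A>), \<complex>)\<close>, realised as the vector space with basis \<open>ebasis H\<close>, \<open>H \<in> \<A>\<close>.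
\<close>

definition Vdual :: "'h set \<Rightarrow> ('h \<Rightarrow> complex) set" where
  "Vdual \<A> = cfun.span (ebasis ` \<A>)"

text \<open>
  The exterior square is realised inside the functions on pairs: \<open>ebasis H \<and> ebasis H'\<close> is the
  antisymmetric function with value \<open>1\<close> at \<open>(H, H')\<close> and \<open>-1\<close> at \<open>(H', H)\<close>. The elements
  \<open>ebasis H \<and> ebasis H'\<close>, one for each unordered pair of distinct \<open>H, H' \<in> \<A>\<close>, are linearly independent,
  so the span of all \<open>wedge a b\<close> with \<open>a, b \<in> Vdual \<A>\<close> is a copy of the exterior square of
  \<open>Vdual \<A>\<close>.
\<close>

definition wedge :: "('h \<Rightarrow> complex) \<Rightarrow> ('h \<Rightarrow> complex) \<Rightarrow> 'h \<times> 'h \<Rightarrow> complex" where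
  "wedge a b = (\<lambda>(H, H'). a H * b H' - a H' * b H)"

definition wedge_space ::
    "('h \<Rightarrow> complex) set \<Rightarrow> ('h \<Rightarrow> complex) set \<Rightarrow> ('h \<times> 'h \<Rightarrow> complex) set" where
  "wedge_space P Q = cfun.span {wedge a b | a b. a \<in> P \<and> b \<in> Q}"

text \<open>
  The kernel of the cup product from the exterior square of \<open>H\<^sup>1(M(\<A>), \<complex>)\<close> to
  \<open>H\<^sup>2(M(\<A>), \<complex>)\<close>, given by its (Orlik-Solomon) generators.
\<close>

definition Kperp ::
    "(complex ^ 'n) set set \<Rightarrow> ((complex ^ 'n) set \<times> (complex ^ 'n) set \<Rightarrow> complex) set" where
  "Kperp \<A> = cfun.span {wedge (ebasis H - ebasis H'') (ebasis H' - ebasis H'') | H H' H''.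
     H \<in> \<A> \<and> H' \<in> \<A> \<and> H'' \<in> \<A> \<and> H \<noteq> H' \<and> H \<noteq> H'' \<and> H' \<noteq> H'' \<and>
     codim (H \<inter> H' \<inter> H'') = 2}"

definition resonance ::
    "(complex ^ 'n) set set \<Rightarrow> ((complex ^ 'n) set \<Rightarrow> complex) set" where
  "resonance \<A> = {a \<in> Vdual \<A>. \<exists>b\<in>Vdual \<A>. wedge a b \<in> Kperp \<A> - {0}} \<union> {0}"


section \<open>Irreducible components in the Zariski topology of \<open>Vdual \<A>\<close>\<close>

inductive poly_fun :: "'h set \<Rightarrow> (('h \<Rightarrow> complex) \<Rightarrow> complex) \<Rightarrow> bool" for \<A> where
  const: "poly_fun \<A> (\<lambda>a. c)"
| coord: "H \<in> \<A> \<Longrightarrow> poly_fun \<A> (\<lambda>a. a H)"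
| add: "poly_fun \<A> f \<Longrightarrow> poly_fun \<A> g \<Longrightarrow> poly_fun \<A> (\<lambda>a. f a + g a)"
| mult: "poly_fun \<A> f \<Longrightarrow> poly_fun \<A> g \<Longrightarrow> poly_fun \<A> (\<lambda>a. f a * g a)"

definition zariski_closed :: "'h set \<Rightarrow> ('h \<Rightarrow> complex) set \<Rightarrow> bool" where
  "zariski_closed \<A> Z \<longleftrightarrow>
     (\<exists>F. (\<forall>f\<in>F. poly_fun \<A> f) \<and> Z = {a \<in> Vdual \<A>. \<forall>f\<in>F. f a = 0})"

definition zariski_irreducible :: "'h set \<Rightarrow> ('h \<Rightarrow> complex) set \<Rightarrow> bool" where
  "zariski_irreducible \<A> W \<longleftrightarrow> W \<subseteq> Vdual \<A> \<and> W \<noteq> {} \<and>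
     (\<forall>Z1 Z2. zariski_closed \<A> Z1 \<and> zariski_closed \<A> Z2 \<and> W \<subseteq> Z1 \<union> Z2
        \<longrightarrow> W \<subseteq> Z1 \<or> W \<subseteq> Z2)"

definition irreducible_component ::
    "'h set \<Rightarrow> ('h \<Rightarrow> complex) set \<Rightarrow> ('h \<Rightarrow> complex) set \<Rightarrow> bool" where
  "irreducible_component \<A> R W \<longleftrightarrow> W \<subseteq> R \<and> zariski_irreducible \<A> W \<and>
     (\<forall>W'. W' \<subseteq> R \<and> zariski_irreducible \<A> W' \<and> W \<subseteq> W' \<longrightarrow> W' = W)"


section \<open>Multinets\<close>

text \<open>
  The classes are \<open>\<B>s 1, \<dots>, \<B>s k\<close>; as parts of a partition they are nonempty.
\<close>

definition multinet ::
    "(complex ^ 'n) set set \<Rightarrow> nat \<Rightarrow> (nat \<Rightarrow> (complex ^ 'n) set set) \<Rightarrow>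
     ((complex ^ 'n) set \<Rightarrow> nat) \<Rightarrow> (complex ^ 'n) set set \<Rightarrow> bool" where
  "multinet \<B> k \<B>s m \<X> \<longleftrightarrow>
     arrangement \<B> \<and> k \<ge> 3 \<and>
     \<B> = (\<Union>i\<in>{1..k}. \<B>s i) \<and> disjoint_family_on \<B>s {1..k} \<and> (\<forall>i\<in>{1..k}. \<B>s i \<noteq> {}) \<and>
     (\<forall>H\<in>\<B>. m H > 0) \<and>
     \<X> \<subseteq> flats2 \<B> \<and>
     (\<exists>d. \<forall>i\<in>{1..k}. (\<Sum>H\<in>\<B>s i. m H) = d) \<and>
     (\<forall>i\<in>{1..k}. \<forall>j\<in>{1..k}. i \<noteq> j \<longrightarrow> (\<forall>H\<in>\<B>s i. \<forall>H'\<in>\<B>s j. H \<inter> H' \<in> \<X>)) \<and>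
     (\<forall>X\<in>\<X>. \<exists>n. \<forall>i\<in>{1..k}. (\<Sum>H | H \<in> \<B>s i \<and> X \<subseteq> H. m H) = n) \<and>
     (\<forall>i\<in>{1..k}. connected (\<Union>(\<B>s i) - \<Union>\<X>))"

definition class_vector :: "('h \<Rightarrow> nat) \<Rightarrow> 'h set \<Rightarrow> 'h \<Rightarrow> complex" where
  "class_vector m C = (\<Sum>H\<in>C. cscale (of_nat (m H)) (ebasis H))"

definition multinet_space ::
    "nat \<Rightarrow> (nat \<Rightarrow> 'h set) \<Rightarrow> ('h \<Rightarrow> nat) \<Rightarrow> ('h \<Rightarrow> complex) set" where
  "multinet_space k \<B>s m =
     cfun.span {class_vector m (\<B>s i) - class_vector m (\<B>s 1) | i. i \<in> {2..k}}"


section \<open>Separability\<close>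

definition separable ::
    "(complex ^ 'n) set set \<Rightarrow> ((complex ^ 'n) set \<Rightarrow> complex) set \<Rightarrow> bool" where
  "separable \<A> P \<longleftrightarrow> wedge_space P (Vdual \<A>) \<inter> Kperp \<A> \<subseteq> wedge_space P P"

end

(* The cardinality bound forces k = 3, makes every flat of the base locus a transversal triple of
   hyperplanes that no further hyperplane contains, and makes the multiplicities constant. Writing
   chi_i for the indicator of the i-th class, an element of (P wedge V) in Kperp is a sum of
   chi_i wedge w_i with w_1 + w_2 + w_3 = 0. On each flat of codimension two the rows of an element
   of Kperp add up to zero. The row of a hyperplane L outside the net shows w_i(L) = 0 for all i; the
   rows of hyperplanes of class i on a flat not in the base locus show that w_i is constant on its own
   class; the rows on the base locus then give w_j(H) + w_j(H') + w_j(H'') = 0 for each transversal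
   triple, so w_j is constant on every class with values adding up to zero, that is, w_j lies in P. *)

theory Submission
  imports Defs
begin

section \<open>Flats of codimension two\<close>

lemma codim_eq_imp_eq:
  fixes X Y :: "(complex ^ 'n) set"
  assumes "vec.subspace X" "vec.subspace Y" "X \<subseteq> Y" "codim X = codim Y"
  shows "X = Y"
proof (rule vec.subspace_dim_equal)
  show "vec.dim Y \<le> vec.dim X"
    \<comment> \<open>Since \<open>codim\<close> is a truncated difference, equal codimensions give
      equal dimensions only because both are at most \<open>CARD('n)\<close>.\<close>
    using assms(4) dim_subset_UNIV_cart_gen[of X] dim_subset_UNIV_cart_gen[of Y]
    unfolding codim_def by linarith
qed (use assms in auto)

text \<open>The sum \<open>?S\<close> strictly contains \<open>H\<close>: otherwise \<open>G\<close>
  would lie in \<open>H\<close> and equal it. Hence \<open>?S\<close> has full dimension, and the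
  dimension formula for sums gives the intersection.\<close>

lemma codim_Int_hyperplanes:
  fixes H G :: "(complex ^ 'n) set"
  assumes "hyperplane H" "hyperplane G" "H \<noteq> G"
  shows "codim (H \<inter> G) = 2"
proof -
  let ?S = "{x + y | x y. x \<in> H \<and> y \<in> G}"
  have H: "vec.subspace H" "codim H = 1" and G: "vec.subspace G" "codim G = 1"
    using assms by (auto simp: hyperplane_def)
  have S: "vec.subspace ?S" by (rule vec.subspace_sums[OF H(1) G(1)])
  have HS: "H \<subseteq> ?S" using vec.subspace_0[OF G(1)] by force
  have GS: "G \<subseteq> ?S" using vec.subspace_0[OF H(1)] by force
  have "vec.dim ?S \<noteq> vec.dim H"
  proof
    assume "vec.dim ?S = vec.dim H"
    then have "H = ?S" using codim_eq_imp_eq[OF H(1) S HS] by (simp add: codim_def)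
    moreover have "G = H"
      using codim_eq_imp_eq[OF G(1) H(1)] GS \<open>H = ?S\<close> H(2) G(2) by simp
    ultimately show False using assms(3) by simp
  qed
  moreover have "vec.dim H \<le> vec.dim ?S" by (rule vec.dim_subset[OF HS])
  moreover have "vec.dim ?S + vec.dim (H \<inter> G) = vec.dim H + vec.dim G"
    by (rule vec.dim_sums_Int[OF H(1) G(1)])
  ultimately show ?thesis
    using H(2) G(2) dim_subset_UNIV_cart_gen[of ?S] unfolding codim_def by linarith
qed

lemma hyperplane_Int_eq:
  assumes "hyperplane H" "hyperplane G" "H \<noteq> G" "vec.subspace Y" "codim Y = 2"
    "Y \<subseteq> H" "Y \<subseteq> G"
  shows "H \<inter> G = Y"
  using codim_eq_imp_eq[of Y "H \<inter> G"] codim_Int_hyperplanes[OF assms(1-3)] assms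
  by (auto simp: hyperplane_def vec.subspace_inter)

text \<open>It suffices to check a generator given by a, b, c. If two of these contain
  \<open>Y\<close>, their common flat is \<open>Y\<close>, so all three do, and both wedge factors
  have coordinate sum zero over the localization. Otherwise at most one of the three lies there, and
  the generator restricted to it could only live on the diagonal, where antisymmetry makes it
  vanish.\<close>

lemma Kperp_row_sum:
  fixes \<A> :: "(complex ^ 'n) set set"
  assumes arr: "arrangement \<A>" and Y: "vec.subspace Y" "codim Y = 2"
    and H: "H \<in> localization \<A> Y" and \<omega>: "\<omega> \<in> Kperp \<A>"
  shows "(\<Sum>G\<in>localization \<A> Y. \<omega> (H, G)) = 0"
proof -
  let ?S = "localization \<A> Y"
  have fin: "finite ?S" using arr by (simp add: arrangement_def localization_def)
  have hyp: "\<And>H. H \<in> \<A> \<Longrightarrow> hyperplane H" using arr by (simp add: arrangement_def)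
  have "Kperp \<A> \<subseteq> {\<omega>. (\<Sum>G\<in>?S. \<omega> (H, G)) = 0}"
    unfolding Kperp_def
  proof (rule cfun.span_minimal)
    show "cfun.subspace {\<omega>. (\<Sum>G\<in>?S. \<omega> (H, G)) = 0}"
      by (rule cfun.subspaceI)
        (auto simp: cscale_def sum.distrib simp flip: sum_distrib_left)
  next
    have "(\<Sum>G\<in>?S. wedge (ebasis a - ebasis c) (ebasis b - ebasis c) (H, G)) = 0"
      if abc: "a \<in> \<A>" "b \<in> \<A>" "c \<in> \<A>" "a \<noteq> b" "a \<noteq> c" "b \<noteq> c" "codim (a \<inter> b \<inter> c) = 2"
      for a b c
    proof -
      have sub: "vec.subspace (a \<inter> b \<inter> c)"
        using abc hyp by (auto simp: hyperplane_def intro!: vec.subspace_inter)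
      have pair: "x \<inter> y = a \<inter> b \<inter> c" if "x \<in> {a, b, c}" "y \<in> {a, b, c}" "x \<noteq> y" for x y
        by (rule hyperplane_Int_eq) (use that abc hyp sub in auto)
      have all: "{a, b, c} \<subseteq> ?S" if "x \<in> ?S" "y \<in> ?S" "x \<in> {a, b, c}" "y \<in> {a, b, c}" "x \<noteq> y"
        for x y
      proof -
        have "x \<inter> y = Y"
          by (rule hyperplane_Int_eq) (use that hyp Y in \<open>auto simp: localization_def\<close>)
        then show ?thesis using pair[OF that(3-5)] abc by (auto simp: localization_def)
      qed
      have s: "(\<Sum>G\<in>?S. ebasis x G) = (if x \<in> ?S then 1 else 0)" for x
        using fin by (simp add: ebasis_def)
      have "(\<Sum>G\<in>?S. wedge (ebasis a - ebasis c) (ebasis b - ebasis c) (H, G)) =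
          (ebasis a H - ebasis c H) * ((\<Sum>G\<in>?S. ebasis b G) - (\<Sum>G\<in>?S. ebasis c G)) -
          ((\<Sum>G\<in>?S. ebasis a G) - (\<Sum>G\<in>?S. ebasis c G)) * (ebasis b H - ebasis c H)"
        by (simp add: wedge_def sum_subtractf flip: sum_distrib_left sum_distrib_right)
      also have "\<dots> = 0"
        unfolding s using all[of a b] all[of a c] all[of b c] abc(4-6) H
        by (auto simp: ebasis_def)
      finally show ?thesis .
    qed
    then show "{wedge (ebasis H - ebasis H'') (ebasis H' - ebasis H'') | H H' H''.
        H \<in> \<A> \<and> H' \<in> \<A> \<and> H'' \<in> \<A> \<and> H \<noteq> H' \<and> H \<noteq> H'' \<and> H' \<noteq> H'' \<and>
        codim (H \<inter> H' \<inter> H'') = 2} \<subseteq> {\<omega>. (\<Sum>G\<in>?S. \<omega> (H, G)) = 0}"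
      by blast
  qed
  then show ?thesis using \<omega> by auto
qed

section \<open>Three-nets without further hyperplanes through the base locus\<close>

lemma third_class:
  fixes i j :: nat
  assumes "i \<in> {1..3}" "j \<in> {1..3}" "i \<noteq> j"
  obtains l where "l \<in> {1..3}" "i \<noteq> l" "j \<noteq> l"
proof -
  have "\<not> {1..3} \<subseteq> {i, j}" using card_mono[of "{i, j}" "{1..3}"] assms(3) by auto
  then show thesis using that by blast
qed

lemma sum_three_classes:
  fixes f :: "nat \<Rightarrow> complex" and i j l :: nat
  assumes "i \<in> {1..3}" "j \<in> {1..3}" "l \<in> {1..3}" "i \<noteq> j" "i \<noteq> l" "j \<noteq> l"
  shows "(\<Sum>i\<in>{1..3}. f i) = f i + f j + f l"
proof -
  have "{i, j, l} = {1..3}" by (rule card_subset_eq) (use assms in auto)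
  then have "(\<Sum>i\<in>{1..3}. f i) = (\<Sum>i\<in>{i, j, l}. f i)" by simp
  then show ?thesis using assms by simp
qed

text \<open>By \<open>third\<close>, the classes form a 3-net, that is, a Latin square. The
  localization there is taken in all of \<open>\<A>\<close>, which also keeps hyperplanes outside
  the net off the base flats. Multiplicities are absent because they will turn out to be
  constant.\<close>

locale isolated_three_net =
  fixes \<A> :: "(complex ^ 'n) set set" and C :: "nat \<Rightarrow> (complex ^ 'n) set set"
  assumes arr: "arrangement \<A>"
    and sub: "i \<in> {1..3} \<Longrightarrow> C i \<subseteq> \<A>"
    and ne: "i \<in> {1..3} \<Longrightarrow> C i \<noteq> {}"
    and disj: "disjoint_family_on C {1..3}"
    and third: "i \<in> {1..3} \<Longrightarrow> j \<in> {1..3} \<Longrightarrow> l \<in> {1..3} \<Longrightarrow> i \<noteq> j \<Longrightarrow> i \<noteq> l \<Longrightarrow> j \<noteq> l \<Longrightarrow>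
      H \<in> C i \<Longrightarrow> G \<in> C j \<Longrightarrow> \<exists>K\<in>C l. localization \<A> (H \<inter> G) = {H, G, K}"
begin

lemma class_unique: "i \<in> {1..3} \<Longrightarrow> j \<in> {1..3} \<Longrightarrow> H \<in> C i \<Longrightarrow> H \<in> C j \<Longrightarrow> i = j"
  using disj unfolding disjoint_family_on_def by blast

text \<open>These are the coordinates of the sum of chi_i wedge w_i over the three classes, with
  chi_i the indicator of \<open>C i\<close>.\<close>

definition form :: "(nat \<Rightarrow> (complex ^ 'n) set \<Rightarrow> complex) \<Rightarrow>
    (complex ^ 'n) set \<Rightarrow> (complex ^ 'n) set \<Rightarrow> complex" where
  "form w H G = (\<Sum>i\<in>{1..3}. indicator (C i) H * w i G - indicator (C i) G * w i H)"

lemma indicator_sum: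
  assumes "i \<in> {1..3}" "H \<in> C i"
  shows "(\<Sum>j\<in>{1..3}. indicator (C j) H * f j) = (f i :: complex)"
proof -
  have "(\<Sum>j\<in>{1..3}. indicator (C j) H * f j) = (\<Sum>j\<in>{1..3}. if j = i then f j else 0)"
    by (rule sum.cong) (use assms class_unique in \<open>auto simp: indicator_def\<close>)
  then show ?thesis using assms by simp
qed

lemma indicator_sum_outside:
  "H \<notin> (\<Union>i\<in>{1..3}. C i) \<Longrightarrow> (\<Sum>j\<in>{1..3}. indicator (C j) H * f j) = (0 :: complex)"
  by (rule sum.neutral) auto

lemma form_split: "form w H G =
    (\<Sum>i\<in>{1..3}. indicator (C i) H * w i G) - (\<Sum>i\<in>{1..3}. indicator (C i) G * w i H)"
  by (simp add: form_def sum_subtractf)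

lemma localization_finite: "finite (localization \<A> Y)"
  using arr by (simp add: arrangement_def localization_def)

lemma localization_Int:
  assumes "H \<in> \<A>" "G \<in> \<A>" "H \<noteq> G" "K \<in> localization \<A> (H \<inter> G)" "K \<noteq> H"
  shows "H \<inter> K = H \<inter> G"
proof (rule hyperplane_Int_eq)
  show "hyperplane H" "hyperplane K" using assms arr by (auto simp: arrangement_def localization_def)
  show "vec.subspace (H \<inter> G)"
    using assms arr by (auto simp: arrangement_def hyperplane_def vec.subspace_inter)
  show "codim (H \<inter> G) = 2"
    using assms arr by (auto simp: arrangement_def intro: codim_Int_hyperplanes)
qed (use assms in \<open>auto simp: localization_def\<close>)

text \<open>A hyperplane \<open>K\<close> of another class on the flat would make it a base flat. By
  \<open>third\<close> it would then carry only \<open>H\<close>, \<open>K\<close> and one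
  hyperplane \<open>F\<close> of the remaining class, leaving no room for \<open>G\<close>.\<close>

lemma localization_monochromatic:
  assumes i: "i \<in> {1..3}" "H \<in> C i" and G: "G \<in> \<A>" "H \<noteq> G" "G \<in> C i \<or> G \<notin> (\<Union>i\<in>{1..3}. C i)"
    and j: "j \<in> {1..3}" and K: "K \<in> localization \<A> (H \<inter> G)" "K \<in> C j"
  shows "j = i"
proof (rule ccontr)
  assume ji: "j \<noteq> i"
  obtain l where l: "l \<in> {1..3}" "i \<noteq> l" "j \<noteq> l" by (rule third_class[OF i(1) j]) (use ji in auto)
  have "K \<noteq> H" using class_unique i j K ji by auto
  then have "H \<inter> K = H \<inter> G" using localization_Int i G K sub by blast
  moreover obtain F where F: "F \<in> C l" "localization \<A> (H \<inter> K) = {H, K, F}"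
    using third[OF i(1) j l(1) _ l(2,3) i(2) K(2)] ji by auto
  ultimately have "G \<in> {H, K, F}" using G(1) by (auto simp: localization_def)
  then show False using G class_unique i j l K(2) F(1) ji by blast
qed

section \<open>Solving the row equations for the weights\<close>

context
  fixes w :: "nat \<Rightarrow> (complex ^ 'n) set \<Rightarrow> complex"
  assumes sum0: "\<And>H. (\<Sum>i\<in>{1..3}. w i H) = 0"
    and row: "\<And>H G F. H \<in> \<A> \<Longrightarrow> G \<in> \<A> \<Longrightarrow> H \<noteq> G \<Longrightarrow> F \<in> localization \<A> (H \<inter> G) \<Longrightarrow>
      (\<Sum>K\<in>localization \<A> (H \<inter> G). form w F K) = 0"
begin

text \<open>Pick \<open>H\<close> of class \<open>i\<close>. The flat of \<open>H\<close> and
  \<open>L\<close> meets no other class, so the row of \<open>L\<close> on it has entry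
  \<open>- w i L\<close> at each hyperplane of class \<open>i\<close> and 0 elsewhere. As
  \<open>H\<close> is one of them, the vanishing row sum is a nonzero multiple of
  \<open>w i L\<close>.\<close>

lemma weight_outside_eq_0:
  assumes i: "i \<in> {1..3}" and L: "L \<in> \<A>" "L \<notin> (\<Union>i\<in>{1..3}. C i)"
  shows "w i L = 0"
proof -
  obtain H where H: "H \<in> C i" using ne i by blast
  let ?S = "localization \<A> (H \<inter> L)"
  have HA: "H \<in> \<A>" "H \<noteq> L" using H i L sub by auto
  have S: "H \<in> ?S" "L \<in> ?S" using HA L by (auto simp: localization_def)
  have form_eq: "form w L K = - (if K \<in> C i then w i L else 0)" if K: "K \<in> ?S" for K
  proof (cases "K \<in> (\<Union>i\<in>{1..3}. C i)")
    case True
    then obtain j where j: "j \<in> {1..3}" "K \<in> C j" by blast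
    have "j = i" by (rule localization_monochromatic[OF i H L(1) HA(2) _ j(1) K j(2)]) (use L in simp)
    then show ?thesis
      using j unfolding form_split indicator_sum_outside[OF L(2)] indicator_sum[OF j] by simp
  next
    case False
    then show ?thesis
      using i unfolding form_split indicator_sum_outside[OF L(2)] indicator_sum_outside[OF False] by auto
  qed
  have "0 = (\<Sum>K\<in>?S. form w L K)" using row[OF HA(1) L(1) HA(2) S(2)] by simp
  also have "\<dots> = - (\<Sum>K\<in>?S. if K \<in> C i then w i L else 0)"
    unfolding sum_negf[symmetric] by (rule sum.cong) (use form_eq in auto)
  also have "\<dots> = - of_nat (card (?S \<inter> C i)) * w i L"
    by (simp flip: sum.inter_restrict add: localization_finite)
  finally have "card (?S \<inter> C i) = 0 \<or> w i L = 0" by simp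
  moreover have "card (?S \<inter> C i) \<noteq> 0" using S H by (auto simp: localization_finite)
  ultimately show ?thesis by simp
qed

text \<open>On the flat of \<open>H\<close> and \<open>G\<close> only class \<open>i\<close> and
  hyperplanes outside the net occur, and on the latter \<open>w i\<close> vanishes. The row of any
  \<open>F\<close> of class \<open>i\<close> then says that \<open>w i F\<close> is the average of
  \<open>w i\<close> over the class \<open>i\<close> hyperplanes on the flat, a number that does not
  depend on \<open>F\<close>.\<close>

lemma weight_const_own_class:
  assumes i: "i \<in> {1..3}" and H: "H \<in> C i" and G: "G \<in> C i"
  shows "w i H = w i G"
proof (cases "H = G")
  case False
  let ?S = "localization \<A> (H \<inter> G)"
  have A: "H \<in> \<A>" "G \<in> \<A>" using H G i sub by auto
  have S: "H \<in> ?S" "G \<in> ?S" using A by (auto simp: localization_def)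
  have avg: "of_nat (card (?S \<inter> C i)) * w i F = (\<Sum>K\<in>?S \<inter> C i. w i K)" if F: "F \<in> ?S" "F \<in> C i" for F
  proof -
    have form_eq: "form w F K = (if K \<in> C i then w i K - w i F else 0)" if K: "K \<in> ?S" for K
    proof (cases "K \<in> (\<Union>i\<in>{1..3}. C i)")
      case True
      then obtain j where j: "j \<in> {1..3}" "K \<in> C j" by blast
      have "j = i" by (rule localization_monochromatic[OF i H A(2) False _ j(1) K j(2)]) (use G in simp)
      then show ?thesis
        using j unfolding form_split indicator_sum[OF i F(2)] indicator_sum[OF j] by simp
    next
      case out: False
      have "K \<in> \<A>" using K by (simp add: localization_def)
      then show ?thesis
        using out i F weight_outside_eq_0[OF i _ out]
        unfolding form_split indicator_sum_outside[OF out] indicator_sum[OF i F(2)] by auto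
    qed
    have "0 = (\<Sum>K\<in>?S. form w F K)" using row[OF A False F(1)] by simp
    also have "\<dots> = (\<Sum>K\<in>?S. if K \<in> C i then w i K - w i F else 0)"
      by (rule sum.cong) (use form_eq in auto)
    also have "\<dots> = (\<Sum>K\<in>?S \<inter> C i. w i K - w i F)"
      by (simp add: sum.inter_restrict localization_finite)
    finally show ?thesis by (simp add: sum_subtractf)
  qed
  have "of_nat (card (?S \<inter> C i)) * w i H = of_nat (card (?S \<inter> C i)) * w i G"
    using avg[OF S(1) H] avg[OF S(2) G] by simp
  moreover have "card (?S \<inter> C i) \<noteq> 0" using S H by (auto simp: localization_finite)
  ultimately show ?thesis by simp
qed simp

text \<open>Use the row of the third hyperplane \<open>K\<close> on the base flat. It yields
  \<open>w l H + w l G - w i K - w j K\<close>, and \<open>sum0\<close> at \<open>K\<close> turns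
  the last two terms into \<open>w l K\<close>.\<close>

lemma weight_sum_base_flat:
  assumes ijl: "i \<in> {1..3}" "j \<in> {1..3}" "l \<in> {1..3}" "i \<noteq> j" "i \<noteq> l" "j \<noteq> l"
    and H: "H \<in> C i" and G: "G \<in> C j"
  obtains K where "K \<in> C l" "w l H + w l G + w l K = 0"
proof -
  obtain K where K: "K \<in> C l" "localization \<A> (H \<inter> G) = {H, G, K}"
    using third[OF ijl H G] by blast
  have A: "H \<in> \<A>" "G \<in> \<A>" using ijl H G sub by auto
  have ne: "H \<noteq> G" "H \<noteq> K" "G \<noteq> K" using class_unique ijl H G K by blast+
  have "0 = (\<Sum>F\<in>localization \<A> (H \<inter> G). form w K F)" using row[OF A ne(1)] K by simp
  also have "\<dots> = form w K H + form w K G + form w K K" using ne K by (simp add: add.assoc)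
  also have "\<dots> = w l H - w i K + (w l G - w j K)"
    unfolding form_split indicator_sum[OF ijl(1) H] indicator_sum[OF ijl(2) G]
      indicator_sum[OF ijl(3) K(1)] by simp
  also have "\<dots> = w l H + w l G + w l K - (\<Sum>i\<in>{1..3}. w i K)"
    unfolding sum_three_classes[OF ijl] by simp
  finally show thesis using that[OF K(1)] unfolding sum0 by simp
qed

text \<open>For a class other than \<open>j\<close>, fix \<open>F\<close> in the remaining class.
  The triple through \<open>H\<close> and \<open>F\<close> closes up in class \<open>j\<close>,
  where \<open>w j\<close> is already constant, so \<open>w j H + w j F\<close> is the same for
  every \<open>H\<close> of class \<open>i\<close>.\<close>

lemma weight_const_class:
  assumes i: "i \<in> {1..3}" and j: "j \<in> {1..3}" and H: "H \<in> C i" "H' \<in> C i"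
  shows "w j H = w j H'"
proof (cases "i = j")
  case False
  obtain l where l: "l \<in> {1..3}" "i \<noteq> l" "j \<noteq> l" by (rule third_class[OF i j False])
  obtain F where F: "F \<in> C l" using ne l by blast
  have own: "w j H + w j F = - w j G" if HG: "H \<in> C i" "G \<in> C j" for H G
  proof -
    obtain K where K: "K \<in> C j" "w j H + w j F + w j K = 0"
      by (rule weight_sum_base_flat[OF i l(1) j l(2) False _ HG(1) F]) (use l in auto)
    then show ?thesis
      using weight_const_own_class[OF j K(1) HG(2)] by (simp add: eq_neg_iff_add_eq_0)
  qed
  obtain G where "G \<in> C j" using ne j by blast
  then have "w j H + w j F = w j H' + w j F" using own[OF H(1)] own[OF H(2)] by simp
  then show ?thesis by simp
next
  case True
  then show ?thesis using weight_const_own_class[OF i H] by simp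
qed

lemma weight_class_values:
  assumes j: "j \<in> {1..3}"
  obtains a where "(\<Sum>i\<in>{1..3}. a i) = 0"
    "\<And>H. H \<in> \<A> \<Longrightarrow> w j H = (\<Sum>i\<in>{1..3}. indicator (C i) H * a i)"
proof -
  \<comment> \<open>One representative per class suffices to read off the values, as
    \<open>w j\<close> is constant on each class.\<close>
  define r where "r i = (SOME H. H \<in> C i)" for i
  have r: "r i \<in> C i" if "i \<in> {1..3}" for i
    unfolding r_def using ne[OF that] by (simp add: some_in_eq)
  define a where "a i = w j (r i)" for i
  obtain i l where il: "i \<in> {1..3}" "l \<in> {1..3}" "i \<noteq> j" "i \<noteq> l" "j \<noteq> l"
  proof -
    define i :: nat where "i = (if j = 1 then 2 else 1)"
    have i: "i \<in> {1..3}" "i \<noteq> j" by (auto simp: i_def)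
    obtain l where "l \<in> {1..3}" "i \<noteq> l" "j \<noteq> l" by (rule third_class[OF i(1) j i(2)])
    then show thesis using that i by blast
  qed
  obtain K where K: "K \<in> C j" "w j (r i) + w j (r l) + w j K = 0"
    by (rule weight_sum_base_flat[OF il(1,2) j il(4,3) _ r[OF il(1)] r[OF il(2)]]) (use il in auto)
  \<comment> \<open>The hyperplane \<open>K\<close> completing the triple need not be the
    representative \<open>r j\<close>, but it has the same weight.\<close>
  have "w j K = a j" unfolding a_def by (rule weight_const_own_class[OF j K(1) r[OF j]])
  then have "(\<Sum>i\<in>{1..3}. a i) = 0"
    using K(2) unfolding sum_three_classes[OF il(1) j il(2-5)] by (simp add: a_def algebra_simps)
  moreover have "w j H = (\<Sum>i\<in>{1..3}. indicator (C i) H * a i)" if "H \<in> \<A>" for H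
  proof (cases "H \<in> (\<Union>i\<in>{1..3}. C i)")
    case True
    then obtain i where i: "i \<in> {1..3}" "H \<in> C i" by blast
    then show ?thesis
      using weight_const_class[OF i(1) j i(2) r[OF i(1)]] unfolding indicator_sum[OF i] a_def by simp
  next
    case False
    then show ?thesis
      unfolding indicator_sum_outside[OF False] by (rule weight_outside_eq_0[OF j that])
  qed
  ultimately show thesis by (rule that)
qed

end

end

section \<open>From a multinet to an isolated three-net\<close>

lemma flats2_mono: "\<B> \<subseteq> \<A> \<Longrightarrow> flats2 \<B> \<subseteq> flats2 \<A>"
proof
  fix X assume BA: "\<B> \<subseteq> \<A>" and "X \<in> flats2 \<B>"
  then obtain S where "S \<subseteq> \<B>" "X = \<Inter>S" "codim X = 2" unfolding flats2_def by auto
  then show "X \<in> flats2 \<A>" using BA unfolding flats2_def by (auto intro!: exI[of _ S])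
qed

text \<open>Balance and positive multiplicities put a hyperplane of every class on each base flat;
  the bound 3 then leaves exactly one per class and nothing else. Balance on such a flat compares
  single multiplicities.\<close>

lemma multinet_isolated_three_net:
  fixes \<A> \<B> :: "(complex ^ 'n) set set"
  assumes arr: "arrangement \<A>" and BA: "\<B> \<subseteq> \<A>" and net: "multinet \<B> k C m \<X>"
    and small: "\<And>Y. Y \<in> flats2 \<A> \<Longrightarrow> (\<exists>H\<in>\<B>. \<exists>H'\<in>\<B>. H \<noteq> H' \<and> Y = H \<inter> H') \<Longrightarrow>
      card (localization \<A> Y) \<le> 3"
  obtains M where "k = 3" "M > 0" "isolated_three_net \<A> C"
    "\<And>i H. i \<in> {1..3} \<Longrightarrow> H \<in> C i \<Longrightarrow> m H = M"
proof -
  have k: "k \<ge> 3" and B: "\<B> = (\<Union>i\<in>{1..k}. C i)" and disj: "disjoint_family_on C {1..k}"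
    and ne: "\<And>i. i \<in> {1..k} \<Longrightarrow> C i \<noteq> {}" and pos: "\<And>H. H \<in> \<B> \<Longrightarrow> m H > 0"
    and X: "\<X> \<subseteq> flats2 \<B>"
    and base: "\<And>i j H G. i \<in> {1..k} \<Longrightarrow> j \<in> {1..k} \<Longrightarrow> i \<noteq> j \<Longrightarrow> H \<in> C i \<Longrightarrow> G \<in> C j \<Longrightarrow>
      H \<inter> G \<in> \<X>"
    and bal': "\<And>Y. Y \<in> \<X> \<Longrightarrow> \<exists>n. \<forall>i\<in>{1..k}. (\<Sum>H | H \<in> C i \<and> Y \<subseteq> H. m H) = n"
    using net unfolding multinet_def by blast+
  have bal: "(\<Sum>H | H \<in> C i \<and> Y \<subseteq> H. m H) = (\<Sum>H | H \<in> C j \<and> Y \<subseteq> H. m H)"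
    if Y: "Y \<in> \<X>" and ij: "i \<in> {1..k}" "j \<in> {1..k}" for Y i j
  proof -
    obtain n where "\<forall>i\<in>{1..k}. (\<Sum>H | H \<in> C i \<and> Y \<subseteq> H. m H) = n" using bal'[OF Y] by (rule exE)
    then show ?thesis using ij by simp
  qed
  have fin: "finite \<A>" using arr by (simp add: arrangement_def)
  have CB: "C i \<subseteq> \<B>" if "i \<in> {1..k}" for i using B that by blast
  have CA: "C i \<subseteq> \<A>" if "i \<in> {1..k}" for i using CB[OF that] BA by blast
  have uniq: "i = j" if "i \<in> {1..k}" "j \<in> {1..k}" "H \<in> C i" "H \<in> C j" for i j H
    using disj that unfolding disjoint_family_on_def by blast
  have finloc: "finite (localization \<A> Y)" for Y using fin by (simp add: localization_def)
  have card3: "card (localization \<A> (H \<inter> G)) \<le> 3"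
    if "i \<in> {1..k}" "j \<in> {1..k}" "i \<noteq> j" "H \<in> C i" "G \<in> C j" for i j H G
  proof (rule small)
    show "H \<inter> G \<in> flats2 \<A>" using base[OF that] X flats2_mono[OF BA] by blast
    have "H \<noteq> G" using uniq[OF that(1,2,4)] that(3,5) by blast
    then show "\<exists>H'\<in>\<B>. \<exists>H''\<in>\<B>. H' \<noteq> H'' \<and> H \<inter> G = H' \<inter> H''"
      using that(4,5) CB[OF that(1)] CB[OF that(2)] by blast
  qed
  \<comment> \<open>A class missing the flat would have multiplicity sum 0 there, and by balance so
    would class \<open>i\<close>, whose sum contains \<open>m H > 0\<close>.\<close>
  have meets: "\<exists>K\<in>C l. H \<inter> G \<subseteq> K"
    if ij: "i \<in> {1..k}" "j \<in> {1..k}" "i \<noteq> j" "H \<in> C i" "G \<in> C j" and l: "l \<in> {1..k}"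
    for i j l H G
  proof (rule ccontr)
    assume "\<not> ?thesis"
    then have "{K. K \<in> C l \<and> H \<inter> G \<subseteq> K} = {}" by blast
    then have "(\<Sum>K | K \<in> C l \<and> H \<inter> G \<subseteq> K. m K) = 0" by (simp only: sum.empty)
    then have "(\<Sum>K | K \<in> C i \<and> H \<inter> G \<subseteq> K. m K) = 0"
      using bal[OF base[OF ij] ij(1) l] by simp
    moreover have "finite {K. K \<in> C i \<and> H \<inter> G \<subseteq> K}"
      using finite_subset[OF CA[OF ij(1)] fin] by simp
    ultimately have "m H = 0" using ij(4) by simp
    then show False using pos[of H] ij(4) CB[OF ij(1)] by (simp add: subset_iff)
  qed
  have i12: "1 \<in> {1..k}" "2 \<in> {1..k}" "(1::nat) \<noteq> 2" using k by auto
  obtain H1 H2 where H12: "H1 \<in> C 1" "H2 \<in> C 2" using ne[OF i12(1)] ne[OF i12(2)] by blast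
  have "k = 3"
  proof -
    \<comment> \<open>One hyperplane through the flat is chosen from each class. Disjointness makes
      the choice injective, so the flat lies on at least \<open>k\<close> hyperplanes.\<close>
    define K where "K l = (SOME K. K \<in> C l \<and> H1 \<inter> H2 \<subseteq> K)" for l
    have K: "K l \<in> C l \<and> H1 \<inter> H2 \<subseteq> K l" if "l \<in> {1..k}" for l
      unfolding K_def by (rule someI_ex) (use meets[OF i12 H12 that] in blast)
    have "inj_on K {1..k}"
    proof (rule inj_onI)
      fix i j assume ij: "i \<in> {1..k}" "j \<in> {1..k}" "K i = K j"
      show "i = j" using uniq[OF ij(1,2), of "K i"] K[OF ij(1)] K[OF ij(2)] ij(3) by simp
    qed
    moreover have "K ` {1..k} \<subseteq> localization \<A> (H1 \<inter> H2)"
      unfolding localization_def using K CA by blast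
    ultimately have "card {1..k} \<le> card (localization \<A> (H1 \<inter> H2))"
      by (rule card_inj_on_le[OF _ _ finloc])
    then show ?thesis using card3[OF i12 H12] k by simp
  qed
  have third: "\<exists>K\<in>C l. localization \<A> (H \<inter> G) = {H, G, K}"
    if ijl: "i \<in> {1..k}" "j \<in> {1..k}" "l \<in> {1..k}" "i \<noteq> j" "i \<noteq> l" "j \<noteq> l" "H \<in> C i" "G \<in> C j"
    for i j l H G
  proof -
    obtain K where K: "K \<in> C l" "H \<inter> G \<subseteq> K" using meets[OF ijl(1,2,4,7,8,3)] by blast
    have "H \<noteq> G" "H \<noteq> K" "G \<noteq> K"
      using uniq[OF ijl(1,2)] uniq[OF ijl(1,3)] uniq[OF ijl(2,3)] ijl(4-8) K(1) by blast+
    then have "card {H, G, K} = 3" by simp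
    moreover have "{H, G, K} \<subseteq> localization \<A> (H \<inter> G)"
      using ijl(7,8) K CA[OF ijl(1)] CA[OF ijl(2)] CA[OF ijl(3)] by (auto simp: localization_def)
    ultimately have "{H, G, K} = localization \<A> (H \<inter> G)"
      using card3[OF ijl(1,2,4,7,8)] finloc by (intro card_seteq) auto
    then show ?thesis using K by blast
  qed
  have mult: "m H = m G"
    if ij: "i \<in> {1..k}" "j \<in> {1..k}" "i \<noteq> j" "H \<in> C i" "G \<in> C j" for i j H G
  proof -
    obtain l where l: "l \<in> {1..k}" "i \<noteq> l" "j \<noteq> l"
      using third_class[of i j] ij(1-3) unfolding \<open>k = 3\<close> by blast
    obtain K where K: "K \<in> C l" "localization \<A> (H \<inter> G) = {H, G, K}"
      using third[OF ij(1,2) l(1) ij(3) l(2,3) ij(4,5)] by blast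
    have loc: "F \<in> {H, G, K}" if "F \<in> \<A>" "H \<inter> G \<subseteq> F" for F
      using K(2) that by (auto simp: localization_def)
    have "G \<notin> C i" "K \<notin> C i" "H \<notin> C j" "K \<notin> C j"
      using uniq[OF ij(1,2)] uniq[OF ij(1) l(1)] uniq[OF ij(2) l(1)] ij(3-5) l(2,3) K(1) by blast+
    then have "{F. F \<in> C i \<and> H \<inter> G \<subseteq> F} = {H}" "{F. F \<in> C j \<and> H \<inter> G \<subseteq> F} = {G}"
      using loc CA[OF ij(1)] CA[OF ij(2)] ij(4,5) by blast+
    then show ?thesis using bal[OF base[OF ij] ij(1,2)] by simp
  qed
  \<comment> \<open>Multiplicities are so far compared only across classes, so within class 1 the
    comparison with \<open>H1\<close> passes through \<open>H2\<close>.\<close>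
  have eqM: "m H = m H1" if i: "i \<in> {1..k}" "H \<in> C i" for i H
  proof (cases "i = 1")
    case True
    then have "H \<in> C 1" using i(2) by simp
    then show ?thesis using mult[OF i12 _ H12(2), of H] mult[OF i12 H12] by simp
  next
    case False
    show ?thesis by (rule mult[OF i(1) i12(1) False i(2) H12(1)])
  qed
  show thesis
  proof (rule that[of "m H1"])
    show "m H1 > 0" using pos CB[OF i12(1)] H12(1) by blast
    show "isolated_three_net \<A> C"
      unfolding isolated_three_net_def
      using arr CA ne disj third unfolding \<open>k = 3\<close> by blast
    show "m H = m H1" if "i \<in> {1..3}" "H \<in> C i" for i H
      using eqM that unfolding \<open>k = 3\<close> by blast
  qed (rule \<open>k = 3\<close>)
qed

section \<open>Separability\<close>

text \<open>Vectors are functions on the whole type, so an identity between them must be checked off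
  \<open>\<A>\<close> as well.\<close>

lemma Vdual_eq_0_outside:
  assumes "v \<in> Vdual \<A>" "H \<notin> \<A>"
  shows "v H = 0"
proof -
  have "cfun.span (ebasis ` \<A>) \<subseteq> {v. v H = 0}"
    by (rule cfun.span_minimal)
      (use assms(2) in \<open>auto simp: ebasis_def cscale_def intro!: cfun.subspaceI\<close>)
  then show ?thesis using assms(1) by (auto simp: Vdual_def)
qed

section \<open>Exterior products with a span of two vectors\<close>

lemma wedge_add_left: "wedge (a + a') b = wedge a b + wedge a' b"
  and wedge_add_right: "wedge a (b + b') = wedge a b + wedge a b'"
  and wedge_scale_left: "wedge (cscale c a) b = cscale c (wedge a b)"
  and wedge_scale_right: "wedge a (cscale c b) = cscale c (wedge a b)"
  by (auto simp: wedge_def cscale_def fun_eq_iff algebra_simps)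

text \<open>Bilinearity moves the coefficients of a combination of \<open>p\<close> and
  \<open>q\<close> onto the second factor, and the resulting sums are closed because
  \<open>Q\<close> is a subspace.\<close>

lemma wedge_space_span_pair:
  assumes Q: "cfun.subspace Q" and \<omega>: "\<omega> \<in> wedge_space (cfun.span {p, q}) Q"
  obtains v u where "v \<in> Q" "u \<in> Q" "\<omega> = wedge p v + wedge q u"
proof -
  let ?W = "{wedge p v + wedge q u | v u. v \<in> Q \<and> u \<in> Q}"
  have "wedge_space (cfun.span {p, q}) Q \<subseteq> ?W"
    unfolding wedge_space_def
  proof (rule cfun.span_minimal)
    show "{wedge a b | a b. a \<in> cfun.span {p, q} \<and> b \<in> Q} \<subseteq> ?W"
    proof safe
      fix a b assume a: "a \<in> cfun.span {p, q}" and b: "b \<in> Q"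
      obtain s t where "a - cscale s p = cscale t q"
        using a by (auto simp: cfun.span_breakdown_eq)
      then have "a = cscale s p + cscale t q" by (simp add: diff_eq_eq add.commute)
      then have "wedge a b = wedge p (cscale s b) + wedge q (cscale t b)"
        by (simp add: wedge_add_left wedge_scale_left wedge_scale_right)
      then show "\<exists>v u. wedge a b = wedge p v + wedge q u \<and> v \<in> Q \<and> u \<in> Q"
        using cfun.subspace_scale[OF Q b] by blast
    qed
    show "cfun.subspace ?W"
    proof (rule cfun.subspaceI)
      have "0 = wedge p 0 + wedge q 0" by (auto simp: wedge_def fun_eq_iff)
      then show "0 \<in> ?W" using cfun.subspace_0[OF Q] by blast
    next
      fix x y assume "x \<in> ?W" "y \<in> ?W"
      then obtain v u v' u' where *: "v \<in> Q" "u \<in> Q" "v' \<in> Q" "u' \<in> Q"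
        "x = wedge p v + wedge q u" "y = wedge p v' + wedge q u'" by blast
      then have "x + y = wedge p (v + v') + wedge q (u + u')"
        by (simp add: wedge_add_right add_ac)
      then show "x + y \<in> ?W" using * cfun.subspace_add[OF Q] by blast
    next
      fix c x assume "x \<in> ?W"
      then obtain v u where *: "v \<in> Q" "u \<in> Q" "x = wedge p v + wedge q u" by blast
      then have "cscale c x = wedge p (cscale c v) + wedge q (cscale c u)"
        by (simp add: wedge_scale_right cfun.scale_right_distrib)
      then show "cscale c x \<in> ?W" using * cfun.subspace_scale[OF Q] by blast
    qed
  qed
  then show thesis using \<omega> that by blast
qed

text \<open>Writing an element as \<open>wedge p v + wedge q u\<close>, it is enough that
  \<open>v\<close> and \<open>u\<close> lie in the span of \<open>p\<close> and \<open>q\<close>. Up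
  to the factor \<open>M\<close> they are two of the weights, whose shape the row equations
  determine.\<close>

lemma (in isolated_three_net) separable_three_net:
  fixes M :: nat
  assumes M: "M > 0" and mM: "\<And>i H. i \<in> {1..3} \<Longrightarrow> H \<in> C i \<Longrightarrow> m H = M"
  shows "separable \<A> (multinet_space 3 C m)"
proof -
  define p where "p = class_vector m (C 2) - class_vector m (C 1)"
  define q where "q = class_vector m (C 3) - class_vector m (C 1)"
  have "{2..3} = {2, 3 :: nat}" by auto
  then have "multinet_space 3 C m =
      cfun.span ((\<lambda>i. class_vector m (C i) - class_vector m (C 1)) ` {2, 3})"
    by (simp only: multinet_space_def Setcompr_eq_image)
  then have P: "multinet_space 3 C m = cfun.span {p, q}"
    by (simp add: p_def q_def)
  have cv: "class_vector m (C i) H = of_nat M * indicator (C i) H" if i: "i \<in> {1..3}" for i H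
  proof -
    have fin: "finite (C i)" using arr sub[OF i] finite_subset by (auto simp: arrangement_def)
    have "class_vector m (C i) H = (\<Sum>G\<in>C i. if H = G then of_nat (m G) else 0)"
      unfolding class_vector_def cscale_def ebasis_def
      by (induction rule: finite_induct[OF fin]) auto
    also have "\<dots> = of_nat M * indicator (C i) H"
      using mM[OF i] fin by (simp add: indicator_def)
    finally show ?thesis .
  qed
  have pq: "p H = of_nat M * (indicator (C 2) H - indicator (C 1) H)"
    "q H = of_nat M * (indicator (C 3) H - indicator (C 1) H)" for H
    by (simp_all add: p_def q_def cv algebra_simps)
  have s3: "(\<Sum>i\<in>{1..3}. f i) = f 1 + f 2 + f 3" for f :: "nat \<Rightarrow> complex"
    by (rule sum_three_classes) auto
  show ?thesis
    unfolding separable_def P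
  proof
    fix \<omega> assume "\<omega> \<in> wedge_space (cfun.span {p, q}) (Vdual \<A>) \<inter> Kperp \<A>"
    then have \<omega>: "\<omega> \<in> wedge_space (cfun.span {p, q}) (Vdual \<A>)" and K: "\<omega> \<in> Kperp \<A>"
      by auto
    have "cfun.subspace (Vdual \<A>)" by (simp add: Vdual_def)
    then obtain v u where vu: "v \<in> Vdual \<A>" "u \<in> Vdual \<A>" and \<omega>_eq: "\<omega> = wedge p v + wedge q u"
      using wedge_space_span_pair[OF _ \<omega>] by blast
    \<comment> \<open>The factor \<open>M\<close> comes from \<open>p\<close> and \<open>q\<close>
      being \<open>M\<close> times differences of indicators. The first indicator enters both with a
      minus sign, whence the value at index 1, which also makes the weights add up to zero.\<close>
    define w where "w i H = of_nat M *
      (if i = 2 then v H else if i = 3 then u H else - v H - u H)" for i :: nat and H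
    have sum0: "(\<Sum>i\<in>{1..3}. w i H) = 0" for H
      unfolding s3 by (simp add: w_def algebra_simps)
    have form: "\<omega> (H, G) = form w H G" for H G
      unfolding form_def s3 by (simp add: \<omega>_eq wedge_def pq w_def algebra_simps)
    have row: "(\<Sum>K\<in>localization \<A> (H \<inter> G). form w F K) = 0"
      if "H \<in> \<A>" "G \<in> \<A>" "H \<noteq> G" "F \<in> localization \<A> (H \<inter> G)" for H G F
    proof -
      have hyp: "hyperplane H" "hyperplane G" using arr that by (auto simp: arrangement_def)
      then have "vec.subspace (H \<inter> G)" by (auto simp: hyperplane_def vec.subspace_inter)
      from Kperp_row_sum[OF arr this codim_Int_hyperplanes[OF hyp that(3)] that(4) K]
      show ?thesis by (simp add: form)
    qed
    have in_span: "x \<in> cfun.span {p, q}"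
      if x: "x \<in> Vdual \<A>" and j: "j \<in> {1..3}" and wx: "\<And>H. w j H = of_nat M * x H" for x j
    proof -
      obtain a where a: "(\<Sum>i\<in>{1..3}. a i) = 0"
        "\<And>H. H \<in> \<A> \<Longrightarrow> w j H = (\<Sum>i\<in>{1..3}. indicator (C i) H * a i)"
        using weight_class_values[of w j] sum0 row j by blast
      have a1: "a 1 = - a 2 - a 3" using a(1) unfolding s3 by algebra
      \<comment> \<open>Eliminating \<open>a 1\<close> leaves \<open>a 2\<close> times chi_2 - chi_1
        plus \<open>a 3\<close> times chi_3 - chi_1. One factor \<open>M\<close> in the denominators
        comes from \<open>w j = M x\<close>, the other from the factor in \<open>p\<close> and
        \<open>q\<close>.\<close>
      have "x H = a 2 / (of_nat M)\<^sup>2 * p H + a 3 / (of_nat M)\<^sup>2 * q H" for H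
      proof (cases "H \<in> \<A>")
        case True
        have "of_nat M * x H = indicator (C 1) H * (- a 2 - a 3) + indicator (C 2) H * a 2 + indicator (C 3) H * a 3"
          using a(2)[OF True] unfolding wx s3 a1 .
        then have "x H = (indicator (C 1) H * (- a 2 - a 3) + indicator (C 2) H * a 2 +
            indicator (C 3) H * a 3) / of_nat M"
          using M by (simp add: eq_divide_eq mult.commute)
        show ?thesis
          unfolding \<open>x H = _\<close> pq using M by (simp add: field_simps power2_eq_square)
      next
        case False
        then have "H \<notin> C i" if "i \<in> {1..3}" for i using sub[OF that] by blast
        then have "H \<notin> C 1" "H \<notin> C 2" "H \<notin> C 3" by auto
        then show ?thesis using Vdual_eq_0_outside[OF x False] by (simp add: pq)
      qed
      then have "x = cscale (a 2 / (of_nat M)\<^sup>2) p + cscale (a 3 / (of_nat M)\<^sup>2) q"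
        by (auto simp: cscale_def fun_eq_iff)
      then show ?thesis
        by (simp add: cfun.span_add cfun.span_scale cfun.span_base)
    qed
    have "v \<in> cfun.span {p, q}" by (rule in_span[OF vu(1), of 2]) (auto simp: w_def)
    moreover have "u \<in> cfun.span {p, q}" by (rule in_span[OF vu(2), of 3]) (auto simp: w_def)
    moreover have "p \<in> cfun.span {p, q}" "q \<in> cfun.span {p, q}" by (simp_all add: cfun.span_base)
    ultimately show "\<omega> \<in> wedge_space (cfun.span {p, q}) (cfun.span {p, q})"
      unfolding wedge_space_def \<omega>_eq by (intro cfun.span_add; intro cfun.span_base; blast)
  qed
qed

theorem theorem9p9:
  fixes \<A> \<B> :: "(complex ^ 'n) set set"
    and k :: nat
    and \<B>s :: "nat \<Rightarrow> (complex ^ 'n) set set"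
    and m :: "(complex ^ 'n) set \<Rightarrow> nat"
    and \<X> :: "(complex ^ 'n) set set"
  assumes "arrangement \<A>"
    and "\<B> \<subset> \<A>"
    and "multinet \<B> k \<B>s m \<X>"
    and "irreducible_component \<A> (resonance \<A>) (multinet_space k \<B>s m)"
    and "\<And>Y. Y \<in> flats2 \<A> \<Longrightarrow> (\<exists>H\<in>\<B>. \<exists>H'\<in>\<B>. H \<noteq> H' \<and> Y = H \<inter> H') \<Longrightarrow>
           card (localization \<A> Y) \<le> 3"
  shows "separable \<A> (multinet_space k \<B>s m)"
proof -
  obtain M where M: "k = 3" "M > 0" "isolated_three_net \<A> \<B>s"
    "\<And>i H. i \<in> {1..3} \<Longrightarrow> H \<in> \<B>s i \<Longrightarrow> m H = M"
    by (rule multinet_isolated_three_net[OF assms(1) _ assms(3,5)]) (use assms(2) in auto)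
  show ?thesis
    unfolding M(1) by (rule isolated_three_net.separable_three_net[OF M(3,2,4)])
qed

end
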